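(* For all MTS $S$, $T$ and $X$ over a finite alphabet $\Sigma$: $X\le_m S/T$ if and only if $T\|X\le_m S$.
   Context: A DMTS is $(S,S^0,\dashrightarrow,\longrightarrow)$ with $S^0\subseteq S$ finite, image-finite may relation $\dashrightarrow\subseteq S\times\Sigma\times S$ and must relation $\longrightarrow\subseteq S\times2^{\Sigma\times S}$, where $s\longrightarrow N$ and $(a,t)\in N$ imply $s\overset a\dashrightarrow t$. An MTS is a DMTS with a single initial state $S^0=\{s^0\}$ in which every must set $N$ is a singleton; we write $s\xrightarrow a t$ for $s\longrightarrow\{(a,t)\}$. DMTS modal refinement $R\subseteq S_1\times S_2$: for all $(s_1,s_2)\in R$, every $s_1\overset a\dashrightarrow t_1$ has some $s_2\overset a\dashrightarrow t_2$ with $(t_1,t_2)\in R$, and every $s_2\longrightarrow N_2$ has some $s_1\longrightarrow N_1$ such that every $(a,t_1)\in N_1$ has some $(a,t_2)\in N_2$ with $(t_1,t_2)\in R$; initialised if each initial state of the left system is related to some initial state of the right; $\le_m$ means an initialised refinement exists. Composition of MTS: $T\|X$ has states $T\times X$, initial state $(t^0,x^0)$, $(t,x)\overset a\dashrightarrow(t',x')$ iff $t\overset a\dashrightarrow t'$ and $x\overset a\dashrightarrow x'$, and $(t,x)\xrightarrow a(t',x')$ iff $t\xrightarrow a t'$ and $x\xrightarrow a x'$. Quotient of MTS $S=(S,\{s^0\},\dashrightarrow_S,\longrightarrow_S)$ by $T=(T,\{t^0\},\dashrightarrow_T,\longrightarrow_T)$: the DMTS $S/T=(Q,\{q^0\},\dashrightarrow_Q,\longrightarrow_Q)$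 with $Q=\mathcal P_{\mathrm{fin}}(S\times T)$ (elements written $\{s_1/t_1,\dots,s_n/t_n\}$) and $q^0=\{s^0/t^0\}$. The state $\emptyset$ has $\emptyset\overset a\dashrightarrow\emptyset$ for all $a\in\Sigma$ and no must transitions. Let $\alpha(x)=\{a\mid\exists y: x\overset a\dashrightarrow y\}$, $\mathrm{May}_a(x)=\{y\mid x\overset a\dashrightarrow y\}$, and for $q=\{s_1/t_1,\dots,s_n/t_n\}\ne\emptyset$, $\gamma(q)=\bigcap_i(\alpha(s_i)\cup(\Sigma\setminus\alpha(t_i)))$. For $a\in\gamma(q)$, writing $\mathrm{May}_a(t_i)=\{t_{i,1},\dots,t_{i,m_i}\}$, $\mathrm{May}_a(q)$ is the set of all $\{s_{i,j}/t_{i,j}\mid 1\le i\le n,1\le j\le m_i\}$ with $s_{i,j}\in\mathrm{May}_a(s_i)$ for all $i,j$; for $a\notin\gamma(q)$, $\mathrm{May}_a(q)=\emptyset$. Then $q\overset a\dashrightarrow_Q q'$ iff $q'\in\mathrm{May}_a(q)$, and for every $i$ and every $s_i\xrightarrow a s'$ there is a must transition $q\longrightarrow_Q\{(a,M)\mid M\in\mathrm{May}_a(q),\ \exists t': s'/t'\in M,\ t_i\xrightarrow a t'\}$; there are no other transitions. *)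

theory Defs
  imports Main
begin

record ('s, 'a) dmts =
  states :: "'s set"
  init :: "'s set"
  may :: "('s \<times> 'a \<times> 's) set"
  must :: "('s \<times> ('a \<times> 's) set) set"

definition May :: "('s, 'a) dmts \<Rightarrow> 'a \<Rightarrow> 's \<Rightarrow> 's set" where
  "May A a x = {y. (x, a, y) \<in> may A}"

definition is_dmts :: "'a set \<Rightarrow> ('s, 'a) dmts \<Rightarrow> bool" where
  "is_dmts \<Sigma> A \<longleftrightarrow>
     init A \<subseteq> states A \<and> finite (init A) \<and>
     may A \<subseteq> states A \<times> \<Sigma> \<times> states A \<and>
     (\<forall>s a. finite (May A a s)) \<and>
     must A \<subseteq> states A \<times> Pow (\<Sigma> \<times> states A) \<and>
     (\<forall>s N a t. (s, N) \<in> must A \<longrightarrow> (a, t) \<in> N \<longrightarrow> (s, a, t) \<in> may A)"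

definition is_mts :: "'a set \<Rightarrow> ('s, 'a) dmts \<Rightarrow> bool" where
  "is_mts \<Sigma> A \<longleftrightarrow>
     is_dmts \<Sigma> A \<and> (\<exists>s0. init A = {s0}) \<and>
     (\<forall>s N. (s, N) \<in> must A \<longrightarrow> (\<exists>a t. N = {(a, t)}))"

definition modal_refinement ::
    "('s, 'a) dmts \<Rightarrow> ('t, 'a) dmts \<Rightarrow> ('s \<times> 't) set \<Rightarrow> bool" where
  "modal_refinement A B R \<longleftrightarrow>
     R \<subseteq> states A \<times> states B \<and>
     (\<forall>(s1, s2) \<in> R.
        (\<forall>a t1. (s1, a, t1) \<in> may A \<longrightarrow> (\<exists>t2. (s2, a, t2) \<in> may B \<and> (t1, t2) \<in> R)) \<and>
        (\<forall>N2. (s2, N2) \<in> must B \<longrightarrow>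
           (\<exists>N1. (s1, N1) \<in> must A \<and>
              (\<forall>(a, t1) \<in> N1. \<exists>t2. (a, t2) \<in> N2 \<and> (t1, t2) \<in> R))))"

definition initialised ::
    "('s, 'a) dmts \<Rightarrow> ('t, 'a) dmts \<Rightarrow> ('s \<times> 't) set \<Rightarrow> bool" where
  "initialised A B R \<longleftrightarrow> (\<forall>s1 \<in> init A. \<exists>s2 \<in> init B. (s1, s2) \<in> R)"

definition refines :: "('s, 'a) dmts \<Rightarrow> ('t, 'a) dmts \<Rightarrow> bool"  (infix "\<le>\<^sub>m" 50) where
  "A \<le>\<^sub>m B \<longleftrightarrow> (\<exists>R. modal_refinement A B R \<and> initialised A B R)"

definition mts_comp ::
    "('t, 'a) dmts \<Rightarrow> ('x, 'a) dmts \<Rightarrow> ('t \<times> 'x, 'a) dmts"  (infixl "\<parallel>\<^sub>m" 70) where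
  "T \<parallel>\<^sub>m X =
     \<lparr>states = states T \<times> states X,
      init = init T \<times> init X,
      may = {((t, x), a, (t', x')) | t x a t' x'. (t, a, t') \<in> may T \<and> (x, a, x') \<in> may X},
      must = {((t, x), {(a, (t', x'))}) | t x a t' x'.
                (t, {(a, t')}) \<in> must T \<and> (x, {(a, x')}) \<in> must X}\<rparr>"

definition alpha :: "('s, 'a) dmts \<Rightarrow> 's \<Rightarrow> 'a set" where
  "alpha A x = {a. \<exists>y. (x, a, y) \<in> may A}"

definition gamma ::
    "'a set \<Rightarrow> ('s, 'a) dmts \<Rightarrow> ('t, 'a) dmts \<Rightarrow> ('s \<times> 't) set \<Rightarrow> 'a set" where
  "gamma \<Sigma> S T q = (\<Inter>(s, t) \<in> q. alpha S s \<union> (\<Sigma> - alpha T t))"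

text \<open>
  Only meant for \<open>q \<noteq> {}\<close>; the state \<open>{}\<close> is treated separately in the quotient.
  The function \<open>f\<close> picks the successor \<open>s\<^sub>i\<^sub>j = f (s\<^sub>i, t\<^sub>i) t\<^sub>i\<^sub>j\<close>
  independently for every element \<open>s\<^sub>i/t\<^sub>i\<close> of \<open>q\<close> and every \<open>t\<^sub>i\<^sub>j\<close>.
\<close>
definition quot_May ::
    "'a set \<Rightarrow> ('s, 'a) dmts \<Rightarrow> ('t, 'a) dmts \<Rightarrow> 'a \<Rightarrow> ('s \<times> 't) set \<Rightarrow> ('s \<times> 't) set set" where
  "quot_May \<Sigma> S T a q =
     (if a \<in> gamma \<Sigma> S T q
      then {{(f (s, t) t', t') | s t t'. (s, t) \<in> q \<and> t' \<in> May T a t} | f.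
              \<forall>(s, t) \<in> q. \<forall>t' \<in> May T a t. f (s, t) t' \<in> May S a s}
      else {})"

definition mts_quot ::
    "'a set \<Rightarrow> ('s, 'a) dmts \<Rightarrow> ('t, 'a) dmts \<Rightarrow> (('s \<times> 't) set, 'a) dmts" where
  "mts_quot \<Sigma> S T =
     \<lparr>states = Fpow (states S \<times> states T),
      init = {{(s0, t0)} | s0 t0. s0 \<in> init S \<and> t0 \<in> init T},
      may = {({}, a, {}) | a. a \<in> \<Sigma>} \<union>
            {(q, a, q') | q a q'. q \<in> Fpow (states S \<times> states T) \<and> q \<noteq> {} \<and>
                                 q' \<in> quot_May \<Sigma> S T a q},
      must = {(q, {(a, M) | M. M \<in> quot_May \<Sigma> S T a q \<and>
                              (\<exists>t'. (s', t') \<in> M \<and> (t, {(a, t')}) \<in> must T)}) | q s t a s'.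
                q \<in> Fpow (states S \<times> states T) \<and> (s, t) \<in> q \<and> (s, {(a, s')}) \<in> must S}\<rparr>"

lemma is_mts_comp:
  assumes "is_mts \<Sigma> T" and "is_mts \<Sigma> X"
  shows "is_mts \<Sigma> (T \<parallel>\<^sub>m X)"
proof -
  have "finite (May (T \<parallel>\<^sub>m X) a p)" for a p
  proof (rule finite_subset)
    show "May (T \<parallel>\<^sub>m X) a p \<subseteq> May T a (fst p) \<times> May X a (snd p)"
      by (auto simp: May_def mts_comp_def)
    show "finite (May T a (fst p) \<times> May X a (snd p))"
      using assms by (simp add: is_mts_def is_dmts_def)
  qed
  note fin = this
  have dT: "is_dmts \<Sigma> T" and dX: "is_dmts \<Sigma> X"
    using assms by (auto simp: is_mts_def)
  obtain t0 x0 where i: "init T = {t0}" "init X = {x0}" using assms by (auto simp: is_mts_def)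
  then have "t0 \<in> states T" "x0 \<in> states X" using dT dX by (auto simp: is_dmts_def)
  then have ini: "init (T \<parallel>\<^sub>m X) = {(t0, x0)}" "(t0, x0) \<in> states (T \<parallel>\<^sub>m X)"
    using i by (auto simp: mts_comp_def)
  have may: "may (T \<parallel>\<^sub>m X) \<subseteq> states (T \<parallel>\<^sub>m X) \<times> \<Sigma> \<times> states (T \<parallel>\<^sub>m X)"
    using dT dX unfolding is_dmts_def mts_comp_def by auto
  have must: "\<exists>a p'. N = {(a, p')} \<and> (p, a, p') \<in> may (T \<parallel>\<^sub>m X)"
    if pN: "(p, N) \<in> must (T \<parallel>\<^sub>m X)" for p N
  proof -
    obtain t x a t' x' where *: "p = (t, x)" "N = {(a, (t', x'))}"
        "(t, {(a, t')}) \<in> must T" "(x, {(a, x')}) \<in> must X"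
      using pN by (auto simp: mts_comp_def)
    have "(t, a, t') \<in> may T" using *(3) dT unfolding is_dmts_def by blast
    moreover have "(x, a, x') \<in> may X" using *(4) dX unfolding is_dmts_def by blast
    ultimately show ?thesis using *(1,2) by (auto simp: mts_comp_def)
  qed
  have must_sub: "must (T \<parallel>\<^sub>m X) \<subseteq> states (T \<parallel>\<^sub>m X) \<times> Pow (\<Sigma> \<times> states (T \<parallel>\<^sub>m X))"
  proof clarify
    fix t x N assume pN: "((t, x), N) \<in> must (T \<parallel>\<^sub>m X)"
    show "(t, x) \<in> states (T \<parallel>\<^sub>m X) \<and> N \<in> Pow (\<Sigma> \<times> states (T \<parallel>\<^sub>m X))"
      using must[OF pN] may by blast
  qed
  have must_may: "(p, a, p') \<in> may (T \<parallel>\<^sub>m X)"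
    if "(p, N) \<in> must (T \<parallel>\<^sub>m X)" "(a, p') \<in> N" for p N a p'
    using must[OF that(1)] that(2) by auto
  have "is_dmts \<Sigma> (T \<parallel>\<^sub>m X)"
    unfolding is_dmts_def using ini fin may must_sub must_may by auto
  then show ?thesis
    unfolding is_mts_def using ini(1) must by blast
qed

lemma quot_May_sub:
  assumes "is_dmts \<Sigma> S" and "is_dmts \<Sigma> T" and "finite q" and "M \<in> quot_May \<Sigma> S T a q"
  shows "M \<subseteq> (\<Union>p \<in> q. May S a (fst p) \<times> May T a (snd p))"
    and "M \<in> Fpow (states S \<times> states T)"
proof -
  show sub: "M \<subseteq> (\<Union>p \<in> q. May S a (fst p) \<times> May T a (snd p))"
  proof -
    obtain f where f: "\<forall>(s, t) \<in> q. \<forall>t' \<in> May T a t. f (s, t) t' \<in> May S a s"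
      and M: "M = {(f (s, t) t', t') | s t t'. (s, t) \<in> q \<and> t' \<in> May T a t}"
      using assms(4) unfolding quot_May_def by (auto split: if_splits)
    show ?thesis unfolding M using f by force
  qed
  have "finite (\<Union>p \<in> q. May S a (fst p) \<times> May T a (snd p))"
    using assms by (auto simp: is_dmts_def)
  then have "finite M" using sub finite_subset by blast
  moreover have "M \<subseteq> states S \<times> states T"
  proof -
    have "May S b s \<subseteq> states S" for b s using assms(1) by (auto simp: is_dmts_def May_def)
    moreover have "May T b t \<subseteq> states T" for b t using assms(2) by (auto simp: is_dmts_def May_def)
    ultimately show ?thesis using sub by blast
  qed
  ultimately show "M \<in> Fpow (states S \<times> states T)" by (simp add: Fpow_def)
qed

lemma is_dmts_quot:
  assumes S: "is_mts \<Sigma> S" and T: "is_mts \<Sigma> T"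
  shows "is_dmts \<Sigma> (mts_quot \<Sigma> S T)"
proof -
  have dS: "is_dmts \<Sigma> S" and dT: "is_dmts \<Sigma> T" using S T by (auto simp: is_mts_def)
  obtain s0 t0 where i: "init S = {s0}" "init T = {t0}" using S T by (auto simp: is_mts_def)
  let ?A = "mts_quot \<Sigma> S T"
  let ?Q = "Fpow (states S \<times> states T)"
  have iq: "init ?A = {{(s0, t0)}}" by (simp add: mts_quot_def i)
  have st: "s0 \<in> states S" "t0 \<in> states T" using dS dT i by (auto simp: is_dmts_def)
  have clo: "M \<in> ?Q" if "q \<in> ?Q" "M \<in> quot_May \<Sigma> S T a q" for q M a
    using quot_May_sub(2)[OF dS dT _ that(2)] that(1) by (simp add: Fpow_def)
  have gam: "a \<in> \<Sigma>" if ne: "q \<noteq> {}" and "M \<in> quot_May \<Sigma> S T a q" for q M a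
  proof -
    have "a \<in> gamma \<Sigma> S T q" using that(2) by (auto simp: quot_May_def split: if_splits)
    moreover obtain s t where "(s, t) \<in> q" using ne by fastforce
    ultimately have "a \<in> alpha S s \<union> (\<Sigma> - alpha T t)" unfolding gamma_def by blast
    then show ?thesis using dS unfolding alpha_def is_dmts_def by blast
  qed
  have fin: "finite (May ?A a q)" for a q
  proof (cases "q \<in> ?Q")
    case True
    have "finite (\<Union>p \<in> q. May S a (fst p) \<times> May T a (snd p))"
      using True dS dT by (auto simp: is_dmts_def Fpow_def)
    moreover have "May ?A a q \<subseteq> Pow (\<Union>p \<in> q. May S a (fst p) \<times> May T a (snd p))"
    proof
      fix M assume "M \<in> May ?A a q"
      then have "M = {} \<or> M \<in> quot_May \<Sigma> S T a q" by (auto simp: May_def mts_quot_def)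
      then show "M \<in> Pow (\<Union>p \<in> q. May S a (fst p) \<times> May T a (snd p))"
        using quot_May_sub(1)[OF dS dT, of q M a] True by (auto simp: Fpow_def)
    qed
    ultimately show ?thesis by (meson finite_Pow_iff finite_subset)
  next
    case False
    then have "May ?A a q = {}" by (auto simp: May_def mts_quot_def Fpow_def)
    then show ?thesis by simp
  qed
  have e: "{} \<in> ?Q" by (simp add: Fpow_def)
  have may: "may ?A \<subseteq> states ?A \<times> \<Sigma> \<times> states ?A"
  proof clarify
    fix q a q' assume "(q, a, q') \<in> may ?A"
    then consider "q = {}" "q' = {}" "a \<in> \<Sigma>"
      | "q \<in> ?Q" "q \<noteq> {}" "q' \<in> quot_May \<Sigma> S T a q"
      unfolding mts_quot_def by auto
    then have "q \<in> ?Q \<and> a \<in> \<Sigma> \<and> q' \<in> ?Q"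
    proof cases
      case 1
      then show ?thesis using e by simp
    next
      case 2
      then show ?thesis using clo[OF 2(1,3)] gam[OF 2(2,3)] by simp
    qed
    then show "q \<in> states ?A \<and> (a, q') \<in> \<Sigma> \<times> states ?A"
      by (simp add: mts_quot_def)
  qed
  have must1: "q \<in> ?Q \<and> (\<forall>(a, M) \<in> N. (q, a, M) \<in> may ?A)" if qN: "(q, N) \<in> must ?A" for q N
  proof -
    obtain s t a s' where *: "q \<in> ?Q" "(s, t) \<in> q"
      "N = {(a, M) | M. M \<in> quot_May \<Sigma> S T a q \<and>
                       (\<exists>t'. (s', t') \<in> M \<and> (t, {(a, t')}) \<in> must T)}"
      using qN unfolding mts_quot_def by auto
    then have "q \<noteq> {}" by blast
    then have "(q, a, M) \<in> may ?A" if "M \<in> quot_May \<Sigma> S T a q" for M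
      using *(1) that by (simp add: mts_quot_def)
    then show ?thesis using *(1,3) by blast
  qed
  have must2: "must ?A \<subseteq> states ?A \<times> Pow (\<Sigma> \<times> states ?A)"
  proof clarify
    fix q N assume qN: "(q, N) \<in> must ?A"
    have "(a, M) \<in> \<Sigma> \<times> states ?A" if "(a, M) \<in> N" for a M
    proof -
      have "(q, a, M) \<in> may ?A" using must1[OF qN] that by auto
      then show ?thesis using may by auto
    qed
    then have "N \<subseteq> \<Sigma> \<times> states ?A" by (rule subrelI)
    then show "q \<in> states ?A \<and> N \<in> Pow (\<Sigma> \<times> states ?A)"
      using must1[OF qN] by (simp add: mts_quot_def)
  qed
  have "init ?A \<subseteq> states ?A" "finite (init ?A)"
    using st unfolding iq by (auto simp: mts_quot_def Fpow_def)
  moreover have "(q, a, M) \<in> may ?A" if "(q, N) \<in> must ?A" "(a, M) \<in> N" for q N a M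
    using must1[OF that(1)] that(2) by auto
  ultimately show ?thesis
    unfolding is_dmts_def using fin may must2 by (intro conjI allI impI)
qed

end

theory Submission
  imports Defs
begin

text \<open>
  A quotient state \<open>{s\<^sub>1/t\<^sub>1, \<dots>, s\<^sub>n/t\<^sub>n}\<close> is a conjunction of obligations: \<open>x\<close> meets it iff
  \<open>(t\<^sub>i, x)\<close> refines \<open>s\<^sub>i\<close> for every \<open>i\<close>. The two constructions \<open>comp_rel\<close> and \<open>quot_rel\<close> below
  translate refinements along this reading. In the direction from the composition to the quotient,
  the refinement chooses a successor \<open>s\<^sub>i\<^sub>j\<close> for each \<open>t\<^sub>i\<^sub>j\<close>; for a must transition
  of some \<open>s\<^sub>i\<close> this choice is overridden at the single \<open>t\<^sub>i\<^sub>j\<close> that answers it.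
\<close>

definition comp_rel :: "('x \<times> ('s \<times> 't) set) set \<Rightarrow> (('t \<times> 'x) \<times> 's) set" where
  "comp_rel R = {((t, x), s) | t x s. \<exists>q. (x, q) \<in> R \<and> (s, t) \<in> q}"

definition quot_rel ::
    "('s, 'a) dmts \<Rightarrow> ('t, 'a) dmts \<Rightarrow> ('x, 'a) dmts \<Rightarrow> (('t \<times> 'x) \<times> 's) set \<Rightarrow>
     ('x \<times> ('s \<times> 't) set) set" where
  "quot_rel S T X R = {(x, q) | x q. x \<in> states X \<and> q \<in> Fpow (states S \<times> states T) \<and>
     (\<forall>(s, t) \<in> q. ((t, x), s) \<in> R)}"

lemma modal_refinement_mayE:
  assumes "modal_refinement A B R" "(s1, s2) \<in> R" "(s1, a, t1) \<in> may A"
  obtains t2 where "(s2, a, t2) \<in> may B" "(t1, t2) \<in> R"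
  using assms unfolding modal_refinement_def by blast

lemma modal_refinementI:
  assumes "R \<subseteq> states A \<times> states B"
    and "\<And>s1 s2 a t1. (s1, s2) \<in> R \<Longrightarrow> (s1, a, t1) \<in> may A \<Longrightarrow>
           \<exists>t2. (s2, a, t2) \<in> may B \<and> (t1, t2) \<in> R"
    and "\<And>s1 s2 N2. (s1, s2) \<in> R \<Longrightarrow> (s2, N2) \<in> must B \<Longrightarrow>
           \<exists>N1. (s1, N1) \<in> must A \<and> (\<forall>(a, t1) \<in> N1. \<exists>t2. (a, t2) \<in> N2 \<and> (t1, t2) \<in> R)"
  shows "modal_refinement A B R"
  unfolding modal_refinement_def using assms by (intro conjI ballI) (simp, clarify, simp)

lemma is_mts_mustE:
  assumes "is_mts \<Sigma> A" "(s, N) \<in> must A"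
  obtains a t where "N = {(a, t)}" "(s, a, t) \<in> may A"
proof -
  obtain a t where N: "N = {(a, t)}" using assms unfolding is_mts_def by blast
  have "\<forall>s N a t. (s, N) \<in> must A \<longrightarrow> (a, t) \<in> N \<longrightarrow> (s, a, t) \<in> may A"
    using assms(1) unfolding is_mts_def is_dmts_def by (elim conjE)
  then have "(s, a, t) \<in> may A" using assms(2) N by simp
  with N show thesis by (rule that)
qed

text \<open>Must sets of an MTS are singletons, so the universally quantified answer
  \<open>N1\<close> becomes one concrete pair; in particular it cannot hold vacuously through an
  empty \<open>N1\<close>.\<close>

lemma modal_refinement_mustE:
  assumes A: "is_mts \<Sigma> A" and "modal_refinement A B R" "(s1, s2) \<in> R" "(s2, N2) \<in> must B"
  obtains a t1 t2 where "(s1, {(a, t1)}) \<in> must A" "(a, t2) \<in> N2" "(t1, t2) \<in> R"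
proof -
  obtain N1 where N1: "(s1, N1) \<in> must A" "\<forall>(a, t1) \<in> N1. \<exists>t2. (a, t2) \<in> N2 \<and> (t1, t2) \<in> R"
    using assms(2-) unfolding modal_refinement_def by fast
  obtain a t1 where "N1 = {(a, t1)}" using is_mts_mustE[OF A N1(1)] by blast
  then show thesis using N1 that by auto
qed

lemma is_mts_may_states:
  assumes "is_mts \<Sigma> A" "(s, a, t) \<in> may A"
  shows "s \<in> states A" "a \<in> \<Sigma>" "t \<in> states A"
proof -
  have "may A \<subseteq> states A \<times> \<Sigma> \<times> states A"
    using assms(1) unfolding is_mts_def is_dmts_def by (elim conjE)
  then show "s \<in> states A" "a \<in> \<Sigma>" "t \<in> states A" using assms(2) by auto
qed

lemma may_comp_iff:
  "((t, x), a, (t', x')) \<in> may (T \<parallel>\<^sub>m X) \<longleftrightarrow> (t, a, t') \<in> may T \<and> (x, a, x') \<in> may X"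
  by (simp add: mts_comp_def)

text \<open>A single member \<open>(s, t)\<close> of \<open>q\<close> suffices: a quotient successor
  of \<open>q\<close> holds a pair for each may successor of \<open>t\<close>, and the must set that
  \<open>q\<close> inherits from \<open>s\<close> demands a matching must of
  \<open>t\<close>.\<close>

lemma modal_refinement_comp_rel:
  assumes S: "is_mts \<Sigma> S" and X: "is_mts \<Sigma> X"
    and R: "modal_refinement X (mts_quot \<Sigma> S T) R"
  shows "modal_refinement (T \<parallel>\<^sub>m X) S (comp_rel R)"
proof (rule modal_refinementI)
  have sub: "R \<subseteq> states X \<times> Fpow (states S \<times> states T)"
    using R unfolding modal_refinement_def by (simp add: mts_quot_def)
  then show "comp_rel R \<subseteq> states (T \<parallel>\<^sub>m X) \<times> states S"
    by (fastforce simp: comp_rel_def mts_comp_def Fpow_def)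
  show "\<exists>s'. (s, a, s') \<in> may S \<and> (p', s') \<in> comp_rel R"
    if ps: "(p, s) \<in> comp_rel R" and step: "(p, a, p') \<in> may (T \<parallel>\<^sub>m X)" for p s a p'
  proof -
    obtain t x t' x' where p: "p = (t, x)" "p' = (t', x')"
      and t: "(t, a, t') \<in> may T" and x: "(x, a, x') \<in> may X"
      using step unfolding mts_comp_def by auto
    obtain q where q: "(x, q) \<in> R" "(s, t) \<in> q"
      using ps p unfolding comp_rel_def by auto
    obtain q' where q': "(q, a, q') \<in> may (mts_quot \<Sigma> S T)" "(x', q') \<in> R"
      using modal_refinement_mayE[OF R q(1) x] by blast
    \<comment> \<open>Since \<open>(s, t)\<close> lies in \<open>q\<close>, the step is not a loop
      of the empty state.\<close>
    then have "q' \<in> quot_May \<Sigma> S T a q"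
      using q(2) unfolding mts_quot_def by auto
    then obtain f where f: "\<forall>(s, t) \<in> q. \<forall>t' \<in> May T a t. f (s, t) t' \<in> May S a s"
      and M: "q' = {(f (s, t) t', t') | s t t'. (s, t) \<in> q \<and> t' \<in> May T a t}"
      unfolding quot_May_def by (auto split: if_splits)
    have t': "t' \<in> May T a t" using t by (simp add: May_def)
    then have "(f (s, t) t', t') \<in> q'" using q(2) unfolding M by blast
    moreover have "(s, a, f (s, t) t') \<in> may S"
      using f q(2) t' unfolding May_def by blast
    ultimately show ?thesis using q'(2) unfolding comp_rel_def p by blast
  qed
  show "\<exists>N1. (p, N1) \<in> must (T \<parallel>\<^sub>m X) \<and>
          (\<forall>(a, p') \<in> N1. \<exists>s'. (a, s') \<in> N \<and> (p', s') \<in> comp_rel R)"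
    if ps: "(p, s) \<in> comp_rel R" and N: "(s, N) \<in> must S" for p s N
  proof -
    obtain t x q where p: "p = (t, x)" and q: "(x, q) \<in> R" "(s, t) \<in> q"
      using ps unfolding comp_rel_def by auto
    obtain a s' where N': "N = {(a, s')}" using is_mts_mustE[OF S N] by blast
    \<comment> \<open>The must set that the quotient derives from the member \<open>(s, t)\<close>
      and the must transition from \<open>s\<close> to \<open>s'\<close>.\<close>
    let ?N = "{(a, M) | M. M \<in> quot_May \<Sigma> S T a q \<and>
                 (\<exists>t'. (s', t') \<in> M \<and> (t, {(a, t')}) \<in> must T)}"
    have "q \<in> Fpow (states S \<times> states T)" using sub q(1) by blast
    then have "(q, ?N) \<in> must (mts_quot \<Sigma> S T)"
      using q(2) N unfolding N' mts_quot_def by auto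
    then obtain b x' M where x: "(x, {(b, x')}) \<in> must X" and M: "(b, M) \<in> ?N" "(x', M) \<in> R"
      by (rule modal_refinement_mustE[OF X R q(1)])
    then obtain t' where "b = a" "(s', t') \<in> M" "(t, {(a, t')}) \<in> must T"
      by auto
    then have "(p, {(a, (t', x'))}) \<in> must (T \<parallel>\<^sub>m X)" "((t', x'), s') \<in> comp_rel R"
      using x M(2) unfolding p mts_comp_def comp_rel_def by auto
    then show ?thesis unfolding N' by blast
  qed
qed

text \<open>Any choice of successors that respects both \<open>S\<close> and \<open>R\<close> yields
  a quotient successor related to \<open>x'\<close>. It serves may steps with an arbitrary choice
  and must steps with a modified one.\<close>

lemma quot_May_quot_rel:
  assumes S: "is_mts \<Sigma> S" and T: "is_mts \<Sigma> T"
    and q: "q \<in> Fpow (states S \<times> states T)"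
    and a: "a \<in> \<Sigma>" and x': "x' \<in> states X"
    and f: "\<And>s t t'. (s, t) \<in> q \<Longrightarrow> (t, a, t') \<in> may T \<Longrightarrow>
              (s, a, f (s, t) t') \<in> may S \<and> ((t', x'), f (s, t) t') \<in> R"
    and M: "M = {(f (s, t) t', t') | s t t'. (s, t) \<in> q \<and> t' \<in> May T a t}"
  shows "M \<in> quot_May \<Sigma> S T a q" "(x', M) \<in> quot_rel S T X R"
proof -
  \<comment> \<open>For a member \<open>(s, t)\<close>, either \<open>t\<close> has no
    \<open>a\<close>-successor, or \<open>f\<close> applied to one supplies an
    \<open>a\<close>-successor of \<open>s\<close>.\<close>
  have "a \<in> gamma \<Sigma> S T q"
    using f a unfolding gamma_def alpha_def by blast
  moreover have "\<forall>(s, t) \<in> q. \<forall>t' \<in> May T a t. f (s, t) t' \<in> May S a s"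
    using f unfolding May_def by auto
  ultimately show quot: "M \<in> quot_May \<Sigma> S T a q"
    unfolding quot_May_def M by auto
  have "M \<in> Fpow (states S \<times> states T)"
    using quot_May_sub(2)[OF _ _ _ quot] S T q by (auto simp: is_mts_def Fpow_def)
  moreover have "\<forall>(s, t) \<in> M. ((t, x'), s) \<in> R"
    using f unfolding M May_def by auto
  ultimately show "(x', M) \<in> quot_rel S T X R"
    using x' unfolding quot_rel_def by auto
qed

text \<open>Each step of \<open>X\<close> is paired with all equally labelled steps of
  \<open>T\<close>, and the answers of \<open>R\<close> are collected into one quotient state. A
  must transition of the composition splits: its \<open>X\<close> half answers the quotient, its
  \<open>T\<close> half places the collected state in the required must set.\<close>

lemma modal_refinement_quot_rel:
  assumes S: "is_mts \<Sigma> S" and T: "is_mts \<Sigma> T" and X: "is_mts \<Sigma> X"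
    and R: "modal_refinement (T \<parallel>\<^sub>m X) S R"
  shows "modal_refinement X (mts_quot \<Sigma> S T) (quot_rel S T X R)"
proof (rule modal_refinementI)
  show "quot_rel S T X R \<subseteq> states X \<times> states (mts_quot \<Sigma> S T)"
    by (auto simp: quot_rel_def mts_quot_def)
  have choice: "\<exists>f. \<forall>s t t'. (s, t) \<in> q \<longrightarrow> (t, a, t') \<in> may T \<longrightarrow>
                  (s, a, f (s, t) t') \<in> may S \<and> ((t', x'), f (s, t) t') \<in> R"
    if xq: "(x, q) \<in> quot_rel S T X R" and x: "(x, a, x') \<in> may X" for x q a x'
  proof -
    \<comment> \<open>The component \<open>t\<close> of \<open>p\<close> serves only to guarantee
      existence; the value depends on \<open>s\<close> and \<open>t'\<close>.\<close>
    let ?f = "\<lambda>p t'. SOME s'. (fst p, a, s') \<in> may S \<and> ((t', x'), s') \<in> R"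
    have "\<exists>s'. (s, a, s') \<in> may S \<and> ((t', x'), s') \<in> R"
      if st: "(s, t) \<in> q" and t: "(t, a, t') \<in> may T" for s t t'
    proof -
      have "((t, x), s) \<in> R" using xq st unfolding quot_rel_def by auto
      moreover have "((t, x), a, (t', x')) \<in> may (T \<parallel>\<^sub>m X)"
        using t x by (simp add: may_comp_iff)
      ultimately show ?thesis using modal_refinement_mayE[OF R] by metis
    qed
    then have "(s, a, ?f (s, t) t') \<in> may S \<and> ((t', x'), ?f (s, t) t') \<in> R"
      if "(s, t) \<in> q" "(t, a, t') \<in> may T" for s t t'
      using someI_ex[of "\<lambda>s'. (s, a, s') \<in> may S \<and> ((t', x'), s') \<in> R"] that by simp
    then show ?thesis by (intro exI[of _ ?f]) blast
  qed
  show "\<exists>q'. (q, a, q') \<in> may (mts_quot \<Sigma> S T) \<and> (x', q') \<in> quot_rel S T X R"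
    if xq: "(x, q) \<in> quot_rel S T X R" and x: "(x, a, x') \<in> may X" for x q a x'
  proof (cases "q = {}")
    \<comment> \<open>The loops of the empty state are separate from \<open>quot_May\<close>, and
      \<open>{}\<close> is again related to \<open>x'\<close>.\<close>
    case True
    then show ?thesis
      using is_mts_may_states[OF X x] by (auto simp: mts_quot_def quot_rel_def Fpow_def)
  next
    case False
    have q: "q \<in> Fpow (states S \<times> states T)" using xq unfolding quot_rel_def by auto
    obtain f where "\<And>s t t'. (s, t) \<in> q \<Longrightarrow> (t, a, t') \<in> may T \<Longrightarrow>
        (s, a, f (s, t) t') \<in> may S \<and> ((t', x'), f (s, t) t') \<in> R"
      using choice[OF xq x] by blast
    note M = quot_May_quot_rel[OF S T q is_mts_may_states(2,3)[OF X x] this refl]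
    show ?thesis
      using M False q unfolding mts_quot_def by auto
  qed
  show "\<exists>N1. (x, N1) \<in> must X \<and>
          (\<forall>(a, x') \<in> N1. \<exists>q'. (a, q') \<in> N \<and> (x', q') \<in> quot_rel S T X R)"
    if xq: "(x, q) \<in> quot_rel S T X R" and must: "(q, N) \<in> must (mts_quot \<Sigma> S T)" for x q N
  proof -
    obtain s t a s' where q: "q \<in> Fpow (states S \<times> states T)" and st: "(s, t) \<in> q"
      and s: "(s, {(a, s')}) \<in> must S"
      and N: "N = {(a, M) | M. M \<in> quot_May \<Sigma> S T a q \<and>
                (\<exists>t'. (s', t') \<in> M \<and> (t, {(a, t')}) \<in> must T)}"
      using must unfolding mts_quot_def by auto
    have "((t, x), s) \<in> R" using xq st unfolding quot_rel_def by auto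
    then obtain b p' u where "((t, x), {(b, p')}) \<in> must (T \<parallel>\<^sub>m X)"
      "(b, u) \<in> {(a, s')}" "(p', u) \<in> R"
      using s by (rule modal_refinement_mustE[OF is_mts_comp[OF T X] R])
    then obtain t' x' where t: "(t, {(a, t')}) \<in> must T" and x: "(x, {(a, x')}) \<in> must X"
      and R': "((t', x'), s') \<in> R"
      unfolding mts_comp_def by auto
    have may: "(t, a, t') \<in> may T" "(x, a, x') \<in> may X" "(s, a, s') \<in> may S"
      using is_mts_mustE[OF T t] is_mts_mustE[OF X x] is_mts_mustE[OF S s] by blast+
    obtain f where f: "\<And>s t t'. (s, t) \<in> q \<Longrightarrow> (t, a, t') \<in> may T \<Longrightarrow>
        (s, a, f (s, t) t') \<in> may S \<and> ((t', x'), f (s, t) t') \<in> R"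
      using choice[OF xq may(2)] by blast
    \<comment> \<open>The choice \<open>f\<close> may miss \<open>s'\<close> at \<open>t'\<close>.
      Forcing it there puts \<open>(s', t')\<close> into \<open>M\<close>, and is admissible because
      the must step of \<open>s\<close> is also a may step and \<open>R'\<close> holds.\<close>
    define g where "g = f((s, t) := (f (s, t))(t' := s'))"
    define M where "M = {(g (s, t) t', t') | s t t'. (s, t) \<in> q \<and> t' \<in> May T a t}"
    have "(u, a, g (u, v) v') \<in> may S \<and> ((v', x'), g (u, v) v') \<in> R"
      if "(u, v) \<in> q" "(v, a, v') \<in> may T" for u v v'
      using f[OF that] may(3) R' unfolding g_def by auto
    note M = quot_May_quot_rel[OF S T q is_mts_may_states(2,3)[OF X may(2)] this M_def]
    have "g (s, t) t' = s'" by (simp add: g_def)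
    then have "(s', t') \<in> M" using st may(1) unfolding M_def May_def by blast
    then have "(a, M) \<in> N" using M(1) t unfolding N by blast
    then show ?thesis using x M(2) by blast
  qed
qed

theorem theorem8:
  fixes \<Sigma> :: "'a set"
    and S :: "('s, 'a) dmts" and T :: "('t, 'a) dmts" and X :: "('x, 'a) dmts"
  assumes "finite \<Sigma>"
    and "is_mts \<Sigma> S" and "is_mts \<Sigma> T" and "is_mts \<Sigma> X"
  shows "X \<le>\<^sub>m mts_quot \<Sigma> S T \<longleftrightarrow> T \<parallel>\<^sub>m X \<le>\<^sub>m S"
proof -
  obtain s0 t0 x0 where i: "init S = {s0}" "init T = {t0}" "init X = {x0}"
    using assms by (auto simp: is_mts_def)
  then have st: "s0 \<in> states S" "t0 \<in> states T" "x0 \<in> states X"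
    using assms by (auto simp: is_mts_def is_dmts_def)
  have init_quot: "initialised X (mts_quot \<Sigma> S T) R \<longleftrightarrow> (x0, {(s0, t0)}) \<in> R" for R
    by (simp add: initialised_def mts_quot_def i)
  have init_comp: "initialised (T \<parallel>\<^sub>m X) S R \<longleftrightarrow> ((t0, x0), s0) \<in> R" for R
    by (simp add: initialised_def mts_comp_def i)
  show ?thesis
  proof
    assume "X \<le>\<^sub>m mts_quot \<Sigma> S T"
    then obtain R where R: "modal_refinement X (mts_quot \<Sigma> S T) R" "(x0, {(s0, t0)}) \<in> R"
      unfolding refines_def init_quot by blast
    then have "((t0, x0), s0) \<in> comp_rel R" unfolding comp_rel_def by blast
    then show "T \<parallel>\<^sub>m X \<le>\<^sub>m S"
      using modal_refinement_comp_rel[OF assms(2,4) R(1)] unfolding refines_def init_comp by blast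
  next
    assume "T \<parallel>\<^sub>m X \<le>\<^sub>m S"
    then obtain R where R: "modal_refinement (T \<parallel>\<^sub>m X) S R" "((t0, x0), s0) \<in> R"
      unfolding refines_def init_comp by blast
    \<comment> \<open>A state with one member carries exactly one obligation, here the initial pair
      of \<open>R\<close>.\<close>
    then have "(x0, {(s0, t0)}) \<in> quot_rel S T X R"
      using st by (simp add: quot_rel_def Fpow_def)
    then show "X \<le>\<^sub>m mts_quot \<Sigma> S T"
      using modal_refinement_quot_rel[OF assms(2-4) R(1)] unfolding refines_def init_quot by blast
  qed
qed

end
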